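(* If there exists a pure $[[n_1,k_1,r_1,d_1]]_2$ subsystem code and a pure $[[n_2,k_2,r_2,d_2]]_2$ subsystem code such that $k_2+r_2\le n_1$, then there exist subsystem codes with parameters $$[[n_1+n_2-k_2-r_2,\;k_1+r_1-r,\;r,\;d]]_2$$ for all $r$ in the range $0\le r<k_1+r_1$, where the minimum distance satisfies $d\ge\min\{d_1,\,d_1+d_2-k_2-r_2\}$.
   Context: Binary case $q=2$. For $(x|y)\in\mathbf{F}_2^{2n}$ (with $x,y\in\mathbf{F}_2^n$), $\mathrm{swt}(x|y)$ is the number of $i$ with $(x_i,y_i)\ne(0,0)$, and $\mathrm{swt}(S)$ is the minimum of $\mathrm{swt}$ over the nonzero elements of $S$. The symplectic product of $(a|b)$ and $(a'|b')$ is $a'\cdot b-a\cdot b'$, and $C^{\perp_s}$ is the dual of $C\subseteq\mathbf{F}_2^{2n}$ with respect to it. All subsystem codes are Clifford subsystem codes: an $((n,K,R,d))_2$ subsystem code is a subspace $Q=A\otimes B$ of $\mathbf{C}^{2^n}$, $\dim A=K$, $\dim B=R$, arising from an additive code; concretely, its existence means that there is an additive subgroup $C\le\mathbf{F}_2^{2n}$ (the zero code is allowed) with $D=C\cap C^{\perp_s}$ such that $|C|=2^nR/K$, $|D|=2^n/(KR)$, and $d=\mathrm{swt}(D^{\perp_s}\setminus C)$ if $D^{\perp_s}\ne C$, while $d=\mathrm{swt}(D^{\perp_s})$ if $D^{\perp_s}=C$ (the case $K=1$). $[[n,k,r,d]]_2$ means $((n,2^k,2^r,d))_2$. The code derived from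 $C$ is pure to $d'$ if $C$ contains no nonzero element of symplectic weight less than $d'$; it is pure if it is pure to its minimum distance $d$. *)

theory Defs
  imports "HOL-Library.Z2" "Jordan_Normal_Form.Matrix"
begin

(* The space of pairs (x|y) with x, y in F_2^n is the set of vectors of length 2n over
   the field bit of two elements: x is the first half, y the second half. *)

definition swt :: "nat \<Rightarrow> bit vec \<Rightarrow> nat" where
  "swt n v = card {i. i < n \<and> (vec_first v n $ i, vec_last v n $ i) \<noteq> (0, 0)}"

(* Inf on nat is the minimum of a nonempty set and 0 on the empty set. Below, the set of
   nonzero elements is empty only for codes of length n = 0. *)
definition min_swt :: "nat \<Rightarrow> bit vec set \<Rightarrow> nat" where
  "min_swt n S = Inf (swt n ` (S - {0\<^sub>v (2 * n)}))"

definition symp_prod :: "nat \<Rightarrow> bit vec \<Rightarrow> bit vec \<Rightarrow> bit" where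
  "symp_prod n v w = vec_first w n \<bullet> vec_last v n - vec_first v n \<bullet> vec_last w n"

definition symp_dual :: "nat \<Rightarrow> bit vec set \<Rightarrow> bit vec set" where
  "symp_dual n C = {v \<in> carrier_vec (2 * n). \<forall>w \<in> C. symp_prod n v w = 0}"

(* Clifford subsystem codes ((n, K, R, d))_2 are given by the additive code C they arise from.
   Since 0 is in C and in D, both cardinalities are positive, which forces K, R > 0. *)
definition gives_subsystem_code :: "nat \<Rightarrow> bit vec set \<Rightarrow> nat \<Rightarrow> nat \<Rightarrow> nat \<Rightarrow> bool" where
  "gives_subsystem_code n C K R d \<longleftrightarrow>
     subgroup C (monoid_vec TYPE(bit) (2 * n)) \<and>
     (let D = C \<inter> symp_dual n C in
        real (card C) = 2 ^ n * real R / real K \<and>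
        real (card D) = 2 ^ n / (real K * real R) \<and>
        d = (if symp_dual n D \<noteq> C then min_swt n (symp_dual n D - C)
             else min_swt n (symp_dual n D)))"

definition pure_to :: "nat \<Rightarrow> bit vec set \<Rightarrow> nat \<Rightarrow> bool" where
  "pure_to n C d' \<longleftrightarrow> \<not> (\<exists>v \<in> C. v \<noteq> 0\<^sub>v (2 * n) \<and> swt n v < d')"

definition ex_subsystem_code :: "nat \<Rightarrow> nat \<Rightarrow> nat \<Rightarrow> nat \<Rightarrow> bool" where
  "ex_subsystem_code n K R d \<longleftrightarrow> (\<exists>C. gives_subsystem_code n C K R d)"

definition ex_pure_subsystem_code :: "nat \<Rightarrow> nat \<Rightarrow> nat \<Rightarrow> nat \<Rightarrow> bool" where
  "ex_pure_subsystem_code n K R d \<longleftrightarrow> (\<exists>C. gives_subsystem_code n C K R d \<and> pure_to n C d)"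

end

(* The subsystem structure of the given codes plays no role: with D = C \<inter> C^\<perp>, purity and the
   definition of d together say that every nonzero element of D^\<perp> has weight at least d. Put
   k = k2 + r2. The stabilizer D2 extends to a self-dual code P on n2 + k coordinates whose
   elements supported on the first n2 coordinates form D2. Gluing D1 to P along k coordinates of
   D1 gives D = (D1 + P) \<inter> {v. v vanishes on the k shared coordinates}, and counting shows that its
   dual is obtained in the same way from D1^\<perp> and P. In characteristic 2 the two summands
   x in D1^\<perp> and y in P of such a vector agree on the shared coordinates. If they vanish there,
   x alone contributes weight d1; otherwise x contributes at least d1 - k outside these
   coordinates, and y contributes a nonzero element of D2^\<perp>, of weight at least d2. Finally D is
   enlarged by r hyperbolic pairs of D^\<perp> to a code C with C \<inter> C^\<perp> = D. *)

theory Submission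
  imports Defs "HOL-Library.Function_Algebras" "HOL-Library.Product_Plus" "HOL-Library.Set_Algebras"
begin

text \<open>Without this, simp rewrites sums and products of bits to XOR and AND, out of reach of
  the ring lemmas used below.\<close>

declare add_bit_eq_xor [simp del] mult_bit_eq_and [simp del]

section \<open>Counting orthogonal complements\<close>

lemma bit_add_self [simp]: "b + b = 0" for b :: bit
  by (cases b) auto

text \<open>Negation has no clause of its own: in the bit spaces below every element is its own
  inverse, so a submonoid is already a subgroup.\<close>

definition additive_code :: "'a::monoid_add set \<Rightarrow> bool" where
  "additive_code S \<longleftrightarrow> 0 \<in> S \<and> (\<forall>x \<in> S. \<forall>y \<in> S. x + y \<in> S)"

lemma additive_codeD:
  assumes "additive_code S"
  shows "0 \<in> S" "x \<in> S \<Longrightarrow> y \<in> S \<Longrightarrow> x + y \<in> S"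
  using assms by (auto simp: additive_code_def)

lemma additive_code_Int: "additive_code S \<Longrightarrow> additive_code T \<Longrightarrow> additive_code (S \<inter> T)"
  by (auto simp: additive_code_def)

lemma additive_code_plus:
  fixes S T :: "'a::comm_monoid_add set"
  assumes "additive_code S" "additive_code T"
  shows "additive_code (S + T)"
  unfolding additive_code_def
proof (intro conjI ballI)
  show "0 \<in> S + T"
    using assms[THEN additive_codeD(1)] set_plus_intro[of 0 S 0 T] by simp
next
  fix x y assume "x \<in> S + T" "y \<in> S + T"
  then obtain a b c d where *: "x = a + b" "y = c + d" "a \<in> S" "b \<in> T" "c \<in> S" "d \<in> T"
    by (elim set_plus_elim)
  have "x + y = (a + c) + (b + d)" by (simp add: * ac_simps)
  then show "x + y \<in> S + T"
    using * assms[THEN additive_codeD(2)] by auto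
qed

lemma subset_set_plus:
  fixes S T :: "'a::comm_monoid_add set"
  shows "0 \<in> T \<Longrightarrow> S \<subseteq> S + T" "0 \<in> S \<Longrightarrow> T \<subseteq> S + T"
  using set_plus_intro[of _ S 0 T] set_plus_intro[of 0 S _ T] by auto

lemma set_plus_subset: "additive_code X \<Longrightarrow> S \<subseteq> X \<Longrightarrow> T \<subseteq> X \<Longrightarrow> S + T \<subseteq> X"
  by (auto simp: additive_code_def set_plus_def)

text \<open>The nontrivial additive character of the field of two elements.\<close>

definition bit_sign :: "bit \<Rightarrow> int" where
  "bit_sign b = (if b = 0 then 1 else - 1)"

text \<open>Orthogonality of characters. If \<open>f v0 = 1\<close> for some \<open>v0\<close> in
  \<open>V\<close>, translation by \<open>v0\<close> permutes \<open>V\<close> and flips every sign,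
  so the sum equals its own negative.\<close>

lemma sum_bit_sign:
  fixes f :: "'a::cancel_ab_semigroup_add \<Rightarrow> bit"
  assumes fin: "finite V" and cl: "\<And>x y. x \<in> V \<Longrightarrow> y \<in> V \<Longrightarrow> x + y \<in> V"
    and add: "\<And>x y. x \<in> V \<Longrightarrow> y \<in> V \<Longrightarrow> f (x + y) = f x + f y"
  shows "(\<Sum>v\<in>V. bit_sign (f v)) = (if \<forall>v\<in>V. f v = 0 then int (card V) else 0)"
proof (cases "\<forall>v\<in>V. f v = 0")
  case True
  then show ?thesis by (simp add: bit_sign_def)
next
  case False
  then obtain v0 where v0: "v0 \<in> V" "f v0 \<noteq> 0" by blast
  have inj: "inj_on ((+) v0) V" by (auto intro: inj_onI)
  have "(+) v0 ` V = V"
    using cl v0(1) by (intro endo_inj_surj[OF fin _ inj]) auto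
  then have "(\<Sum>v\<in>V. bit_sign (f v)) = (\<Sum>v\<in>V. bit_sign (f (v0 + v)))"
    using sum.reindex[OF inj, of "\<lambda>v. bit_sign (f v)"] by simp
  also have "\<dots> = (\<Sum>v\<in>V. - bit_sign (f v))"
    using v0 add by (intro sum.cong) (auto simp: bit_sign_def)
  finally have "(\<Sum>v\<in>V. bit_sign (f v)) = 0" by (simp add: sum_negf)
  with False show ?thesis by auto
qed

text \<open>Double counting of the sum of \<open>bit_sign (B u v)\<close> over all pairs: a row
  contributes \<open>card V\<close> or 0, a column \<open>card U\<close> or 0. The form may be
  degenerate and \<open>U\<close>, \<open>V\<close> may differ, so the same count later gives the
  sizes of duals, of projections and of glued codes.\<close>

lemma card_annihilators:
  fixes B :: "'a::cancel_comm_monoid_add \<Rightarrow> 'b::cancel_comm_monoid_add \<Rightarrow> bit"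
  assumes U: "finite U" "additive_code U" and V: "finite V" "additive_code V"
    and addl: "\<And>x y z. B (x + y) z = B x z + B y z"
    and addr: "\<And>x y z. B x (y + z) = B x y + B x z"
  shows "card V * card {u \<in> U. \<forall>v \<in> V. B u v = 0} = card U * card {v \<in> V. \<forall>u \<in> U. B u v = 0}"
proof -
  note clU = additive_codeD(2)[OF U(2)] and clV = additive_codeD(2)[OF V(2)]
  have "int (card V * card {u \<in> U. \<forall>v \<in> V. B u v = 0}) =
        (\<Sum>u\<in>U. if \<forall>v\<in>V. B u v = 0 then int (card V) else 0)"
    using U(1) by (simp add: sum.inter_filter[symmetric])
  also have "\<dots> = (\<Sum>u\<in>U. \<Sum>v\<in>V. bit_sign (B u v))"
    using V clV addr by (simp add: sum_bit_sign)
  also have "\<dots> = (\<Sum>v\<in>V. \<Sum>u\<in>U. bit_sign (B u v))"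
    by (rule sum.swap)
  also have "\<dots> = (\<Sum>v\<in>V. if \<forall>u\<in>U. B u v = 0 then int (card U) else 0)"
    using U clU addl by (simp add: sum_bit_sign)
  also have "\<dots> = int (card U * card {v \<in> V. \<forall>u \<in> U. B u v = 0})"
    using V(1) by (simp add: sum.inter_filter[symmetric])
  finally show ?thesis by (simp only: of_nat_eq_iff)
qed

section \<open>The symplectic space over a finite index set\<close>

lemma pauli_add_self [simp]: "v + v = 0" for v :: "'i \<Rightarrow> bit \<times> bit"
  by (auto simp: fun_eq_iff zero_prod_def plus_prod_def)

lemma pauli_add_eq_0_iff: "v + w = 0 \<longleftrightarrow> v = w" for v :: "'i \<Rightarrow> bit \<times> bit"
  by (metis add_left_cancel pauli_add_self)

lemma pauli_add_cancel: "v + (v + w) = w" for v :: "'i \<Rightarrow> bit \<times> bit"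
  by (simp flip: add.assoc)

lemma bit_pair_add_self [simp]: "p + p = 0" for p :: "bit \<times> bit"
  by (auto simp: zero_prod_def plus_prod_def)

lemma bit_pair_add_eq_0_iff: "p + q = 0 \<longleftrightarrow> p = q" for p :: "bit \<times> bit"
  by (metis add_left_cancel bit_pair_add_self)

text \<open>Codes of different lengths live in one function type, each supported on its own
  coordinate set. They can then be added and intersected directly, which is what gluing along shared
  coordinates requires.\<close>

definition supp_space :: "'i set \<Rightarrow> ('i \<Rightarrow> bit \<times> bit) set" where
  "supp_space I = {v. \<forall>i. i \<notin> I \<longrightarrow> v i = 0}"

definition weight :: "('i \<Rightarrow> bit \<times> bit) \<Rightarrow> nat" where
  "weight v = card {i. v i \<noteq> 0}"

lemma supp_space_mono: "I \<subseteq> J \<Longrightarrow> supp_space I \<subseteq> supp_space J"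
  by (auto simp: supp_space_def)

lemma additive_code_supp_space: "additive_code (supp_space I)"
  by (auto simp: additive_code_def supp_space_def)

lemma card_UNIV_bit_pair: "card (UNIV :: (bit \<times> bit) set) = 4"
proof -
  have "(UNIV :: bit set) = {0, 1}" by (auto intro: bit_not_one_iff[THEN iffD1])
  then have "card (UNIV :: bit set) = card {0, 1 :: bit}" by (simp only:)
  also have "\<dots> = 2" by simp
  finally have "card (UNIV :: bit set) = 2" .
  then show ?thesis by (simp add: card_cartesian_product flip: UNIV_Times_UNIV)
qed

lemma
  assumes "finite I"
  shows finite_supp_space: "finite (supp_space I)"
    and card_supp_space: "card (supp_space I) = 4 ^ card I"
proof -
  have "bij_betw (\<lambda>v. restrict v I) (supp_space I) (I \<rightarrow>\<^sub>E UNIV)"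
    by (rule bij_betwI[where g = "\<lambda>v i. if i \<in> I then v i else 0"])
      (auto simp: supp_space_def fun_eq_iff PiE_def extensional_def)
  then have "card (supp_space I) = 4 ^ card I"
    using assms by (simp add: bij_betw_same_card card_PiE card_UNIV_bit_pair)
  then show "finite (supp_space I)" "card (supp_space I) = 4 ^ card I"
    by (auto intro: card_ge_0_finite)
qed

lemma card_set_plus:
  fixes S T :: "('i \<Rightarrow> bit \<times> bit) set"
  assumes S: "additive_code S" and T: "additive_code T" and ST: "S \<inter> T \<subseteq> {0}"
  shows "card (S + T) = card S * card T"
proof -
  have "inj_on (\<lambda>(x, y). x + y) (S \<times> T)"
  proof (rule inj_onI, clarify)
    fix a b c d
    assume *: "a \<in> S" "b \<in> T" "c \<in> S" "d \<in> T" "a + b = c + d"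
    then have "(a + c) + (b + d) = 0"
      by (metis (no_types, lifting) ac_simps pauli_add_self)
    then have "a + c = b + d" by (simp add: pauli_add_eq_0_iff)
    moreover have "a + c \<in> S" "b + d \<in> T"
      using * additive_codeD(2)[OF S] additive_codeD(2)[OF T] by auto
    ultimately have "a + c \<in> S \<inter> T" "b + d \<in> S \<inter> T" by auto
    then have "a + c = 0" "b + d = 0" using ST by auto
    then show "a = c \<and> b = d" by (simp add: pauli_add_eq_0_iff)
  qed
  moreover have "S + T = (\<lambda>(x, y). x + y) ` (S \<times> T)"
    by (auto simp: set_plus_def)
  ultimately show ?thesis by (simp add: card_image card_cartesian_product)
qed

section \<open>The symplectic form and duals relative to a coordinate set\<close>

locale symplectic_space =
  fixes \<Omega> :: "'i set"
  assumes finite_\<Omega>: "finite \<Omega>"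
begin

definition form :: "('i \<Rightarrow> bit \<times> bit) \<Rightarrow> ('i \<Rightarrow> bit \<times> bit) \<Rightarrow> bit" where
  "form v w = (\<Sum>i\<in>\<Omega>. fst (v i) * snd (w i) + snd (v i) * fst (w i))"

text \<open>The form runs over all of \<open>\<Omega>\<close>, and only the ambient space depends on
  \<open>I\<close>; thus a single form serves for the duals inside several overlapping coordinate
  sets.\<close>

definition dual :: "'i set \<Rightarrow> ('i \<Rightarrow> bit \<times> bit) set \<Rightarrow> ('i \<Rightarrow> bit \<times> bit) set" where
  "dual I S = {v \<in> supp_space I. \<forall>w \<in> S. form v w = 0}"

lemma finite_subset_space: "S \<subseteq> supp_space I \<Longrightarrow> I \<subseteq> \<Omega> \<Longrightarrow> finite S"
  by (meson finite_\<Omega> finite_subset finite_supp_space)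

lemma form_add_left: "form (v + w) x = form v x + form w x"
  unfolding form_def sum.distrib[symmetric]
  by (intro sum.cong) (auto simp: fst_add snd_add algebra_simps)

lemma form_sym: "form v w = form w v"
  unfolding form_def by (intro sum.cong) (auto simp: algebra_simps)

lemma form_add_right: "form x (v + w) = form x v + form x w"
  by (simp add: form_sym[of x] form_add_left)

lemma form_self [simp]: "form v v = 0"
  unfolding form_def by (simp add: mult.commute)

lemma form_0 [simp]: "form 0 v = 0" "form v 0 = 0"
  unfolding form_def by simp_all

lemma form_single:
  assumes "i \<in> \<Omega>"
  shows "form v (\<lambda>j. if j = i then p else 0) = fst (v i) * snd p + snd (v i) * fst p"
proof -
  have "form v (\<lambda>j. if j = i then p else 0) =
      (\<Sum>j\<in>\<Omega>. if j = i then fst (v i) * snd p + snd (v i) * fst p else 0)"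
    unfolding form_def by (intro sum.cong) auto
  then show ?thesis using assms finite_\<Omega> by simp
qed

lemma form_disjoint:
  assumes "v \<in> supp_space I" "w \<in> supp_space J" "I \<inter> J = {}"
  shows "form v w = 0"
  unfolding form_def
proof (intro sum.neutral ballI)
  fix i
  have "v i = 0 \<or> w i = 0" using assms by (auto simp: supp_space_def)
  then show "fst (v i) * snd (w i) + snd (v i) * fst (w i) = 0" by auto
qed

text \<open>Pairing with (0,1) and (1,0) at a single coordinate reads off the two components there.
  Vanishing on \<open>J\<close> thereby becomes an annihilator condition, which
  \<open>card_annihilators\<close> can count.\<close>

lemma orth_supp_space_iff:
  assumes "J \<subseteq> \<Omega>"
  shows "(\<forall>w \<in> supp_space J. form v w = 0) \<longleftrightarrow> (\<forall>i \<in> J. v i = 0)"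
proof
  assume *: "\<forall>w \<in> supp_space J. form v w = 0"
  show "\<forall>i \<in> J. v i = 0"
  proof
    fix i assume i: "i \<in> J"
    have "form v (\<lambda>j. if j = i then p else 0) = 0" for p
      using * i by (auto simp: supp_space_def)
    from this[of "(0, 1)"] this[of "(1, 0)"] show "v i = 0"
      using i assms by (auto simp: form_single subset_iff zero_prod_def prod_eq_iff)
  qed
next
  assume "\<forall>i \<in> J. v i = 0"
  then have "v \<in> supp_space (- J)" by (auto simp: supp_space_def)
  then show "\<forall>w \<in> supp_space J. form v w = 0" using form_disjoint by blast
qed

lemma dual_subset: "dual I S \<subseteq> supp_space I"
  by (auto simp: dual_def)

lemma additive_code_dual: "additive_code (dual I S)"
  using additive_code_supp_space[of I] by (auto simp: dual_def additive_code_def form_add_left)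

text \<open>In \<open>card_annihilators\<close>, the annihilator inside \<open>S\<close> is {0},
  because the form is nondegenerate on \<open>supp_space I\<close>.\<close>

lemma card_dual:
  assumes I: "I \<subseteq> \<Omega>" and S: "S \<subseteq> supp_space I" "additive_code S"
  shows "card S * card (dual I S) = 4 ^ card I"
proof -
  have fin: "finite I" using I finite_\<Omega> finite_subset by auto
  have "card S * card {v \<in> supp_space I. \<forall>w \<in> S. form v w = 0} =
      card (supp_space I) * card {w \<in> S. \<forall>v \<in> supp_space I. form v w = 0}"
    by (rule card_annihilators)
      (use S fin finite_supp_space[OF fin] finite_subset in
        \<open>auto simp: form_add_left form_add_right additive_code_supp_space\<close>)
  moreover have "{w \<in> S. \<forall>v \<in> supp_space I. form v w = 0} = {0}"
  proof -
    have "w = 0" if "w \<in> S" "\<forall>v \<in> supp_space I. form w v = 0" for w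
      using that S(1) orth_supp_space_iff[OF I, of w] by (auto simp: supp_space_def fun_eq_iff)
    then show ?thesis using additive_codeD(1)[OF S(2)] by (auto simp: form_sym[of _ _])
  qed
  ultimately show ?thesis by (simp add: dual_def card_supp_space[OF fin])
qed

text \<open>One inclusion is immediate from symmetry; applying \<open>card_dual\<close> to
  \<open>S\<close> and to its dual shows that both sides have the same size.\<close>

lemma dual_dual:
  assumes I: "I \<subseteq> \<Omega>" and S: "S \<subseteq> supp_space I" "additive_code S"
  shows "dual I (dual I S) = S"
proof (rule sym, rule card_subset_eq)
  show "finite (dual I (dual I S))" using dual_subset finite_subset_space I by blast
  show "S \<subseteq> dual I (dual I S)" using S(1) by (auto simp: dual_def form_sym)
  have "card (dual I S) * card (dual I (dual I S)) = card (dual I S) * card S"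
    using card_dual[OF assms] card_dual[OF I dual_subset additive_code_dual] by (simp add: mult.commute)
  moreover have "card (dual I S) \<noteq> 0"
    using card_dual[OF assms] by (metis mult_0_right power_not_zero zero_neq_numeral)
  ultimately show "card S = card (dual I (dual I S))" by simp
qed

section \<open>Hyperbolic pairs and the extensions built from them\<close>

lemma obtain_hyperbolic_pair:
  assumes I: "I \<subseteq> \<Omega>" and S: "S \<subseteq> supp_space I" "additive_code S"
    and lt: "card (S \<inter> dual I S) < card (dual I S)"
  obtains e f where "e \<in> dual I S" "f \<in> dual I S" "form e f = 1"
proof -
  have "\<not> (\<forall>e \<in> dual I S. \<forall>f \<in> dual I S. form e f = 0)"
  proof
    assume "\<forall>e \<in> dual I S. \<forall>f \<in> dual I S. form e f = 0"
    \<comment> \<open>A dual on which the form vanishes lies in its own dual, which is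
      \<open>S\<close>; the cardinality hypothesis excludes this.\<close>
    then have "dual I S \<subseteq> dual I (dual I S)" unfolding dual_def by blast
    then have "dual I S \<subseteq> S" using dual_dual[OF I S] by simp
    then have "S \<inter> dual I S = dual I S" by blast
    with lt show False by simp
  qed
  then show ?thesis using that by auto
qed

text \<open>The span of \<open>e\<close> and \<open>f\<close> over the field of two
  elements.\<close>

definition pair_code :: "('i \<Rightarrow> bit \<times> bit) \<Rightarrow> ('i \<Rightarrow> bit \<times> bit) \<Rightarrow> ('i \<Rightarrow> bit \<times> bit) set" where
  "pair_code e f = {0, e, f, e + f}"

lemma additive_code_pair_code: "additive_code (pair_code e f)"
  by (auto simp: additive_code_def pair_code_def ac_simps pauli_add_cancel)

lemma card_pair_code: "e \<noteq> 0 \<Longrightarrow> f \<noteq> 0 \<Longrightarrow> e \<noteq> f \<Longrightarrow> card (pair_code e f) = 4"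
  unfolding pair_code_def
  by (auto simp: card_insert_if pauli_add_eq_0_iff)

lemma pair_code_subset: "additive_code S \<Longrightarrow> e \<in> S \<Longrightarrow> f \<in> S \<Longrightarrow> pair_code e f \<subseteq> S"
  by (auto simp: pair_code_def additive_code_def)

text \<open>Induction on \<open>r\<close>: \<open>C\<close> is \<open>D\<close> plus
  \<open>r\<close> mutually orthogonal hyperbolic planes, which leave the radical equal to
  \<open>D\<close>. As long as \<open>r < m\<close>, the dual of \<open>C\<close> is larger than
  this radical and supplies another pair. Each plane is one gauge qubit.\<close>

lemma extend_by_hyperbolic_pairs:
  assumes I: "I \<subseteq> \<Omega>" and D: "additive_code D" "D \<subseteq> dual I D"
    and card_D: "card D * 2 ^ m = 2 ^ card I" and r: "r \<le> m"
  shows "\<exists>C. additive_code C \<and> C \<subseteq> supp_space I \<and> C \<inter> dual I C = D \<and> card C = card D * 4 ^ r"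
  using r
proof (induction r)
  case 0
  then show ?case using D dual_subset[of I D] by (intro exI[of _ D]) auto
next
  case (Suc r)
  then obtain C where C: "additive_code C" "C \<subseteq> supp_space I" "C \<inter> dual I C = D"
    "card C = card D * 4 ^ r" by auto
  have D0: "card D > 0" using card_D by (metis gr0I mult_0 power_not_zero zero_neq_numeral)
  \<comment> \<open>Squaring \<open>card_D\<close> makes it comparable with
    \<open>card_dual\<close>: the dual of \<open>C\<close> has \<open>card D * 4 ^ (m - r)\<close>
    elements, more than \<open>card D\<close>.\<close>
  have "4 ^ card I = (card D * 2 ^ m) * (card D * 2 ^ m)"
    by (simp add: card_D flip: power_mult_distrib)
  also have "\<dots> = card D * card D * 4 ^ m"
    by (simp add: algebra_simps flip: power_mult_distrib)
  finally have "card D * 4 ^ r * card (dual I C) = card D * card D * 4 ^ m"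
    using card_dual[OF I C(2,1)] C(4) by simp
  moreover have "(4::nat) ^ r < 4 ^ m" using Suc.prems by simp
  ultimately have "card D * 4 ^ r * card D < card D * 4 ^ r * card (dual I C)"
    using D0 by (simp add: algebra_simps)
  then have "card (C \<inter> dual I C) < card (dual I C)" using C(3) by simp
  then obtain e f where ef: "e \<in> dual I C" "f \<in> dual I C" "form e f = 1"
    using obtain_hyperbolic_pair[OF I C(2,1)] by metis
  define T where "T = pair_code e f"
  have T: "additive_code T" "T \<subseteq> dual I C"
    unfolding T_def using additive_code_pair_code pair_code_subset[OF additive_code_dual ef(1,2)] by auto
  \<comment> \<open>The form is nondegenerate on \<open>T\<close>. Since \<open>C\<close> is
    orthogonal to \<open>T\<close>, this gives both the direct sum and the unchanged
    radical.\<close>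
  have T0: "t = 0" if "t \<in> T" "form t e = 0" "form t f = 0" for t
    using that ef(3) by (auto simp: T_def pair_code_def form_add_left form_sym[of f e])
  have CT: "form c t = 0" if "c \<in> C" "t \<in> T" for c t
    using that T(2) by (auto simp: dual_def form_sym)
  have eT: "e \<in> T" "f \<in> T" by (auto simp: T_def pair_code_def)
  have "C \<inter> T \<subseteq> {0}"
  proof
    fix x assume "x \<in> C \<inter> T"
    then show "x \<in> {0}" using T0[of x] CT[of x] eT by auto
  qed
  moreover have "card T = 4"
    unfolding T_def using ef(3) by (intro card_pair_code) auto
  ultimately have "card (C + T) = card D * 4 ^ Suc r"
    using card_set_plus[OF C(1) T(1)] C(4) by simp
  moreover have "C + T \<subseteq> supp_space I"
    using C(2) T(2) dual_subset[of I C] by (intro set_plus_subset additive_code_supp_space) auto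
  moreover have "(C + T) \<inter> dual I (C + T) = D"
  proof (intro equalityI subsetI)
    fix z assume z: "z \<in> (C + T) \<inter> dual I (C + T)"
    then obtain c t where ct: "z = c + t" "c \<in> C" "t \<in> T" by (auto elim: set_plus_elim)
    have orth: "form z w = 0" if "w \<in> C + T" for w using z that by (auto simp: dual_def)
    \<comment> \<open>Against elements of \<open>T\<close> only the \<open>T\<close>-component of
      \<open>z\<close> is visible, so this component is 0.\<close>
    have "form z w = form t w" if "w \<in> T" for w
      using CT[OF ct(2) that] by (simp add: ct(1) form_add_left)
    then have "t = 0" using T0[OF ct(3)] eT orth subset_set_plus(2)[OF additive_codeD(1)[OF C(1)], of T]
      by (metis subsetD)
    then have "z \<in> C" using ct by simp
    moreover have "z \<in> dual I C"
      using \<open>z \<in> C\<close> C(2) orth subset_set_plus(1)[OF additive_codeD(1)[OF T(1)], of C]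
      by (auto simp: dual_def)
    ultimately show "z \<in> D" using C(3) by auto
  next
    fix z assume z: "z \<in> D"
    then have zC: "z \<in> C" "z \<in> dual I C" using C(3) by auto
    then have "form z (c + t) = 0" if "c \<in> C" "t \<in> T" for c t
      using that CT[of z t] by (auto simp: dual_def form_add_right)
    then show "z \<in> (C + T) \<inter> dual I (C + T)"
      using zC subset_set_plus(1)[OF additive_codeD(1)[OF T(1)], of C]
      by (auto simp: dual_def elim!: set_plus_elim)
  qed
  ultimately show ?case using additive_code_plus[OF C(1) T(1)] by blast
qed

text \<open>Each step appends anticommuting single-qubit operators at a new coordinate \<open>t\<close> to a
  hyperbolic pair \<open>e\<close>, \<open>f\<close> of logical operators, so that the two become orthogonal.\<close>

lemma isotropic_extension:
  assumes I: "I \<union> J \<subseteq> \<Omega>" "I \<inter> J = {}" and D: "additive_code D" "D \<subseteq> dual I D"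
    and card_D: "card D * 2 ^ k = 2 ^ card I" and k: "card J \<le> k"
  shows "\<exists>P. additive_code P \<and> P \<subseteq> dual (I \<union> J) P \<and> P \<inter> supp_space I = D \<and>
    card P = card D * 4 ^ card J"
proof -
  have "finite J" using I finite_\<Omega> finite_subset by blast
  then show ?thesis using I k
  proof (induction J)
    case empty
    then show ?case using D dual_subset[of I D] by (intro exI[of _ D]) auto
  next
    case (insert t J)
    then obtain P where P: "additive_code P" "P \<subseteq> dual (I \<union> J) P" "P \<inter> supp_space I = D"
      "card P = card D * 4 ^ card J" by auto
    have IJ: "I \<union> J \<subseteq> \<Omega>" and t: "t \<in> \<Omega>" "t \<notin> I \<union> J" using insert by auto
    have P_supp: "P \<subseteq> supp_space (I \<union> J)" using P(2) dual_subset by blast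
    have finI: "finite I" using insert.prems(1) finite_\<Omega> finite_subset by blast
    have D0: "card D > 0" using card_D by (metis gr0I mult_0 power_not_zero zero_neq_numeral)
    \<comment> \<open>Squared sizes again: the dual of \<open>P\<close> is larger than
      \<open>P\<close> by the factor \<open>4 ^ (k - card J)\<close>, and \<open>card J < k\<close>
      since \<open>t\<close> is still to be added.\<close>
    have "card P * card P * 4 ^ k = (card D * 2 ^ k) * (card D * 2 ^ k) * 4 ^ card J * 4 ^ card J"
      unfolding P(4) by (simp add: algebra_simps flip: power_mult_distrib)
    also have "\<dots> = 4 ^ card I * 4 ^ card J * 4 ^ card J"
      by (simp add: card_D flip: power_mult_distrib)
    also have "4 ^ card I * 4 ^ card J = card P * card (dual (I \<union> J) P)"
      using card_dual[OF IJ P_supp P(1)] insert.hyps finI insert.prems(2)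
      by (simp add: card_Un_disjoint power_add)
    finally have "card P * card P * 4 ^ k = card P * card (dual (I \<union> J) P) * 4 ^ card J" .
    moreover have "card P > 0" using D0 P(4) by simp
    ultimately have eq: "card P * 4 ^ k = card (dual (I \<union> J) P) * 4 ^ card J" by simp
    have "(4::nat) ^ card J < 4 ^ k" using insert.prems(3) insert.hyps by simp
    then have "card P * 4 ^ card J < card P * 4 ^ k" using \<open>card P > 0\<close> by simp
    then have "card P < card (dual (I \<union> J) P)" unfolding eq by simp
    moreover have "P \<inter> dual (I \<union> J) P = P" using P(2) by blast
    ultimately obtain e f where ef: "e \<in> dual (I \<union> J) P" "f \<in> dual (I \<union> J) P" "form e f = 1"
      using obtain_hyperbolic_pair[OF IJ P_supp P(1)] by metis
    define x where "x = (\<lambda>j. if j = t then (1::bit, 0::bit) else 0)"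
    define z where "z = (\<lambda>j. if j = t then (0::bit, 1::bit) else 0)"
    have et: "e t = 0" "f t = 0" using ef t dual_subset by (auto simp: dual_def supp_space_def)
    have form_x: "form v x = snd (v t)" and form_z: "form v z = fst (v t)" for v
      using form_single[OF t(1)] by (auto simp: x_def z_def)
    \<comment> \<open>The terms \<open>form e f = 1\<close> and \<open>form x z = 1\<close> cancel;
      the mixed terms vanish because \<open>e\<close> and \<open>f\<close> are 0 at
      \<open>t\<close>.\<close>
    have "form (e + x) (f + z) = form e f + form x f + (form e z + form x z)"
      by (simp add: form_add_left form_add_right)
    also have "\<dots> = 0"
      unfolding form_sym[of x f] form_x form_z by (simp add: ef(3) et x_def)
    finally have ef_orth: "form (e + x) (f + z) = 0" .
    define T where "T = pair_code (e + x) (f + z)"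
    have T: "additive_code T" by (simp add: T_def additive_code_pair_code)
    have at_t: "(e + x) t = (1, 0)" "(f + z) t = (0, 1)" "(e + x + (f + z)) t = (1, 1)"
      using et by (auto simp: x_def z_def)
    \<comment> \<open>The nonzero elements of \<open>T\<close> are nonzero at \<open>t\<close>,
      where all of \<open>P\<close> vanishes. Hence the sum \<open>P + T\<close> is direct and gains
      no element supported on \<open>I\<close>.\<close>
    have T0: "s = 0" if "s \<in> T" "s t = 0" for s
      using that at_t by (auto simp: T_def pair_code_def zero_prod_def)
    have Pt: "p t = 0" if "p \<in> P" for p using that P_supp t(2) by (auto simp: supp_space_def)
    have "form p (e + x) = 0" "form p (f + z) = 0" if "p \<in> P" for p
      using that ef Pt[OF that] by (auto simp: form_add_right form_x form_z dual_def form_sym[of p])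
    then have PT: "form p s = 0" if "p \<in> P" "s \<in> T" for p s
      using that by (auto simp: T_def pair_code_def form_add_right)
    have TT: "form s s' = 0" if "s \<in> T" "s' \<in> T" for s s'
      using that ef_orth
      by (auto simp: T_def pair_code_def form_add_right[of _ "e + x"] form_add_left[of "e + x"] form_sym[of "f + z" "e + x"])
    have "P \<inter> T \<subseteq> {0}" using T0 Pt by auto
    moreover have "card T = 4"
      unfolding T_def
    proof (rule card_pair_code)
      have *: "v \<noteq> w" if "v t \<noteq> w t" for v w :: "'i \<Rightarrow> bit \<times> bit"
        using that by blast
      show "e + x \<noteq> 0" "f + z \<noteq> 0" "e + x \<noteq> f + z"
        by (rule *, unfold at_t zero_fun_apply zero_prod_def, simp)+
    qed
    ultimately have card: "card (P + T) = card D * 4 ^ card (insert t J)"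
      using card_set_plus[OF P(1) T] P(4) insert.hyps by simp
    have "e + x \<in> supp_space (I \<union> insert t J)" "f + z \<in> supp_space (I \<union> insert t J)"
      using ef by (auto simp: dual_def supp_space_def x_def z_def)
    then have "T \<subseteq> supp_space (I \<union> insert t J)"
      unfolding T_def by (intro pair_code_subset additive_code_supp_space)
    moreover have "P \<subseteq> supp_space (I \<union> insert t J)"
      using P_supp supp_space_mono[of "I \<union> J" "I \<union> insert t J"] by auto
    ultimately have supp: "P + T \<subseteq> supp_space (I \<union> insert t J)"
      by (intro set_plus_subset additive_code_supp_space)
    have PP: "form p p' = 0" if "p \<in> P" "p' \<in> P" for p p'
      using that P(2) by (auto simp: dual_def)
    have "form (p + s) (p' + s') = 0" if "p \<in> P" "s \<in> T" "p' \<in> P" "s' \<in> T" for p s p' s'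
      using that PP[of p p'] PT[of p s'] PT[of p' s] TT[of s s']
      by (simp add: form_add_left form_add_right form_sym[of s p'])
    then have "P + T \<subseteq> dual (I \<union> insert t J) (P + T)"
      using supp by (auto simp: dual_def elim!: set_plus_elim)
    moreover have "(P + T) \<inter> supp_space I = D"
    proof (intro equalityI subsetI)
      fix v assume v: "v \<in> (P + T) \<inter> supp_space I"
      then obtain p s where ps: "v = p + s" "p \<in> P" "s \<in> T" by (auto elim: set_plus_elim)
      have "v t = 0" using v t by (auto simp: supp_space_def)
      then have "s = 0" using T0[OF ps(3)] Pt[OF ps(2)] ps(1) by simp
      then show "v \<in> D" using ps v P(3) by auto
    next
      fix v assume "v \<in> D"
      then show "v \<in> (P + T) \<inter> supp_space I"
        using P(3) subset_set_plus(1)[OF additive_codeD(1)[OF T], of P] by auto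
    qed
    ultimately show ?case using additive_code_plus[OF P(1) T] card by blast
  qed
qed

end

section \<open>Gluing a code to a self-dual extension of another code\<close>

text \<open>The first code will live on \<open>A\<close> and \<open>J\<close>, the second on
  \<open>I\<close>, and \<open>J\<close> is where they are glued. The first size condition makes the
  isotropic \<open>P\<close> self-dual on \<open>I \<union> J\<close>. The elements of
  \<open>P\<close> vanishing on \<open>J\<close> are those of
  \<open>P \<inter> supp_space I\<close>, so the second condition says that \<open>P\<close>
  projects onto the whole space over \<open>J\<close>.\<close>

locale contraction = symplectic_space \<Omega> for \<Omega> :: "'i set" +
  fixes A I J :: "'i set" and P :: "('i \<Rightarrow> bit \<times> bit) set"
  assumes subset_\<Omega>: "A \<union> I \<union> J \<subseteq> \<Omega>"
    and disjoint: "A \<inter> I = {}" "A \<inter> J = {}" "I \<inter> J = {}"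
    and code_P: "additive_code P"
    and isotropic_P: "P \<subseteq> dual (I \<union> J) P"
    and card_P: "card P * card P = 4 ^ (card I + card J)"
    and card_P_Int: "card (P \<inter> supp_space I) * 4 ^ card J = card P"
begin

lemma finite_parts: "finite A" "finite I" "finite J"
  using subset_\<Omega> finite_\<Omega> by (auto intro: finite_subset)

lemma P_supp: "P \<subseteq> supp_space (I \<union> J)"
  using isotropic_P dual_subset by blast

text \<open>Since \<open>P\<close> projects onto the whole space over \<open>J\<close>, nothing
  nonzero supported on \<open>J\<close> is orthogonal to it; \<open>card_annihilators\<close> turns
  \<open>card_P_Int\<close> into this statement.\<close>

lemma orth_P:
  assumes "w \<in> supp_space J" "\<forall>p \<in> P. form p w = 0"
  shows "w = 0"
proof -
  have sub: "I \<union> J \<subseteq> \<Omega>" "J \<subseteq> \<Omega>" using subset_\<Omega> by auto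
  have "card (supp_space J) * card {p \<in> P. \<forall>w \<in> supp_space J. form p w = 0} =
      card P * card {w \<in> supp_space J. \<forall>p \<in> P. form p w = 0}"
    by (rule card_annihilators)
      (use finite_subset_space[OF P_supp] finite_subset_space[OF subset_refl] sub code_P in
        \<open>auto simp: form_add_left form_add_right additive_code_supp_space\<close>)
  moreover have "{p \<in> P. \<forall>w \<in> supp_space J. form p w = 0} = P \<inter> supp_space I"
    unfolding orth_supp_space_iff[OF sub(2)]
    using P_supp disjoint(3) by (auto simp: supp_space_def)
  moreover have "card P \<noteq> 0"
    using card_P by (metis mult_0_right power_not_zero zero_neq_numeral)
  ultimately have "card {w \<in> supp_space J. \<forall>p \<in> P. form p w = 0} = 1"
    using card_P_Int by (simp add: card_supp_space[OF finite_parts(3)] mult.commute)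
  then obtain a where "{w \<in> supp_space J. \<forall>p \<in> P. form p w = 0} = {a}"
    by (rule card_1_singletonE)
  moreover have "0 \<in> {w \<in> supp_space J. \<forall>p \<in> P. form p w = 0}"
    by (auto simp: supp_space_def)
  ultimately show ?thesis using assms by auto
qed

lemma P_Int_supp_space: "P \<inter> supp_space J \<subseteq> {0}"
  using orth_P isotropic_P by (fastforce simp: dual_def)

text \<open>For \<open>S\<close> supported on \<open>A \<union> J\<close>, a sum
  \<open>x + y\<close> vanishes on \<open>J\<close> exactly when \<open>x\<close> and
  \<open>y\<close> agree there. The elements are therefore the gluings of matching pairs, with the
  part of \<open>x\<close> on \<open>A\<close> and the part of \<open>y\<close> on \<open>I\<close>
  retained.\<close>

definition contract :: "('i \<Rightarrow> bit \<times> bit) set \<Rightarrow> ('i \<Rightarrow> bit \<times> bit) set" where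
  "contract S = (S + P) \<inter> supp_space (A \<union> I)"

lemma contractE:
  assumes "z \<in> contract S"
  obtains x y where "z = x + y" "x \<in> S" "y \<in> P" "x + y \<in> supp_space (A \<union> I)"
  using assms by (auto simp: contract_def elim!: set_plus_elim)

lemma contract_subset: "contract S \<subseteq> supp_space (A \<union> I)"
  by (simp add: contract_def)

lemma contract_mono: "S \<subseteq> T \<Longrightarrow> contract S \<subseteq> contract T"
  by (auto simp: contract_def set_plus_def)

lemma additive_code_contract: "additive_code S \<Longrightarrow> additive_code (contract S)"
  unfolding contract_def
  by (intro additive_code_Int additive_code_plus code_P additive_code_supp_space)

text \<open>The sum \<open>S + P\<close> is direct, since a common element is supported on
  \<open>J\<close> and lies in \<open>P\<close>. Vanishing on \<open>J\<close> then costs the full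
  factor \<open>4 ^ card J\<close>, because by \<open>orth_P\<close> only 0 in
  \<open>supp_space J\<close> is orthogonal to \<open>S + P\<close>.\<close>

lemma card_contract:
  assumes S: "S \<subseteq> supp_space (A \<union> J)" "additive_code S"
  shows "card (contract S) * 4 ^ card J = card S * card P"
proof -
  have sub: "A \<union> I \<union> J \<subseteq> \<Omega>" "J \<subseteq> \<Omega>" using subset_\<Omega> by auto
  have SP: "S + P \<subseteq> supp_space (A \<union> I \<union> J)"
    using S(1) P_supp by (fastforce simp: supp_space_def elim!: set_plus_elim)
  have "S \<inter> P \<subseteq> P \<inter> supp_space J"
    using S(1) P_supp disjoint by (fastforce simp: supp_space_def)
  then have "card (S + P) = card S * card P"
    using P_Int_supp_space by (intro card_set_plus S(2) code_P) blast
  moreover have "card (supp_space J) * card {u \<in> S + P. \<forall>v \<in> supp_space J. form u v = 0} =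
      card (S + P) * card {v \<in> supp_space J. \<forall>u \<in> S + P. form u v = 0}"
    by (rule card_annihilators)
      (use finite_subset_space[OF SP] finite_subset_space[OF subset_refl] sub S(2) code_P in
        \<open>auto simp: form_add_left form_add_right additive_code_supp_space intro: additive_code_plus\<close>)
  moreover have "{u \<in> S + P. \<forall>v \<in> supp_space J. form u v = 0} = contract S"
    unfolding orth_supp_space_iff[OF sub(2)]
    using SP disjoint by (auto simp: contract_def supp_space_def subset_iff)
  moreover have "{v \<in> supp_space J. \<forall>u \<in> S + P. form u v = 0} = {0}"
    using orth_P subset_set_plus(2)[OF additive_codeD(1)[OF S(2)], of P]
    by (auto simp: additive_codeD(1)[OF additive_code_supp_space])
  ultimately show ?thesis by (simp add: card_supp_space[OF finite_parts(3)] mult.commute)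
qed

text \<open>On \<open>J\<close> the two summands of a vector supported in \<open>A \<union> I\<close> agree, so the mixed terms cancel.\<close>

lemma form_contract:
  assumes x: "x \<in> supp_space (A \<union> J)" "x' \<in> supp_space (A \<union> J)" and y: "y \<in> P" "y' \<in> P"
    and xy: "x + y \<in> supp_space (A \<union> I)" "x' + y' \<in> supp_space (A \<union> I)"
  shows "form (x + y) (x' + y') = form x x'"
proof -
  have y_supp: "y \<in> supp_space (I \<union> J)" "y' \<in> supp_space (I \<union> J)" using y P_supp by auto
  have "form x y' = form x' y"
    unfolding form_def
  proof (rule sum.cong[OF refl])
    fix i
    have "i \<in> J \<or> (x i = 0 \<and> x' i = 0) \<or> (y i = 0 \<and> y' i = 0)"
      using x y_supp disjoint by (auto simp: supp_space_def)
    then consider "i \<in> J" | "x i = 0 \<and> x' i = 0" | "y i = 0 \<and> y' i = 0" by blast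
    then show "fst (x i) * snd (y' i) + snd (x i) * fst (y' i) =
        fst (x' i) * snd (y i) + snd (x' i) * fst (y i)"
    proof cases
      case 1
      then have "i \<notin> A \<union> I" using disjoint by auto
      then have "x i + y i = 0" "x' i + y' i = 0" using xy by (auto simp: supp_space_def)
      then have "y i = x i" "y' i = x' i" by (auto simp: bit_pair_add_eq_0_iff)
      then show ?thesis by (simp add: algebra_simps)
    qed auto
  qed
  moreover have "form y y' = 0" using y isotropic_P by (auto simp: dual_def)
  ultimately show ?thesis
    by (simp add: form_add_left form_add_right form_sym[of y x'])
qed

text \<open>\<open>form_contract\<close> reduces orthogonality of glued vectors to that of their
  components on \<open>A \<union> J\<close>, which gives one inclusion; counting gives
  equality.\<close>

lemma dual_contract:
  assumes S: "S \<subseteq> supp_space (A \<union> J)" "additive_code S"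
  shows "dual (A \<union> I) (contract S) = contract (dual (A \<union> J) S)"
proof (rule sym, rule card_subset_eq)
  have sub: "A \<union> I \<subseteq> \<Omega>" "A \<union> J \<subseteq> \<Omega>" using subset_\<Omega> by auto
  show "finite (dual (A \<union> I) (contract S))" by (rule finite_subset_space[OF dual_subset sub(1)])
  show "contract (dual (A \<union> J) S) \<subseteq> dual (A \<union> I) (contract S)"
  proof
    fix z assume z: "z \<in> contract (dual (A \<union> J) S)"
    have "form z z' = 0" if z': "z' \<in> contract S" for z'
    proof -
      obtain x y where xy: "z = x + y" "x \<in> dual (A \<union> J) S" "y \<in> P" "x + y \<in> supp_space (A \<union> I)"
        using z by (rule contractE)
      obtain x' y' where xy': "z' = x' + y'" "x' \<in> S" "y' \<in> P" "x' + y' \<in> supp_space (A \<union> I)"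
        using z' by (rule contractE)
      have "form z z' = form x x'"
        unfolding xy(1) xy'(1) using xy xy' S(1) dual_subset by (intro form_contract) blast+
      then show ?thesis using xy(2) xy'(2) by (simp add: dual_def)
    qed
    then show "z \<in> dual (A \<union> I) (contract S)"
      using z contract_subset by (auto simp: dual_def)
  qed
  \<comment> \<open>The two factors \<open>4 ^ card J\<close> lost in \<open>card_contract\<close>
    are matched by one from \<open>S\<close> and its dual inside \<open>A \<union> J\<close> and one
    from \<open>card P * card P\<close>.\<close>
  have "card (contract S) * card (contract (dual (A \<union> J) S)) * (4 ^ card J * 4 ^ card J) =
      (card (contract S) * 4 ^ card J) * (card (contract (dual (A \<union> J) S)) * 4 ^ card J)"
    by (simp add: ac_simps)
  also have "\<dots> = (card S * card P) * (card (dual (A \<union> J) S) * card P)"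
    by (simp only: card_contract[OF S] card_contract[OF dual_subset additive_code_dual])
  also have "\<dots> = (card S * card (dual (A \<union> J) S)) * (card P * card P)"
    by (simp add: ac_simps)
  also have "\<dots> = 4 ^ (card A + card I) * (4 ^ card J * 4 ^ card J)"
    unfolding card_dual[OF sub(2) S] card_P
    using disjoint finite_parts by (simp add: card_Un_disjoint power_add)
  also have "4 ^ (card A + card I) = card (contract S) * card (dual (A \<union> I) (contract S))"
    using card_dual[OF sub(1) contract_subset additive_code_contract[OF S(2)]] disjoint finite_parts
    by (simp add: card_Un_disjoint)
  finally have "card (contract S) * card (contract (dual (A \<union> J) S)) =
      card (contract S) * card (dual (A \<union> I) (contract S))"
    by simp
  moreover have "card (contract S) \<noteq> 0"
    using card_dual[OF sub(1) contract_subset additive_code_contract[OF S(2)]]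
    by (metis mult_0 power_not_zero zero_neq_numeral)
  ultimately show "card (contract (dual (A \<union> J) S)) = card (dual (A \<union> I) (contract S))" by simp
qed

text \<open>The two alternatives are that \<open>x\<close> vanishes on \<open>J\<close> or not. In
  the second, at most \<open>card J\<close> of the weight of \<open>x\<close> is lost; writing this
  as an addition avoids truncated subtraction.\<close>

lemma weight_contract:
  assumes x: "x \<in> supp_space (A \<union> J)" "d1 \<le> weight x"
    and y: "y \<in> P" and xy: "x + y \<in> supp_space (A \<union> I)"
    and d2: "\<And>v. v \<in> dual I (P \<inter> supp_space I) \<Longrightarrow> v \<noteq> 0 \<Longrightarrow> d2 \<le> weight v"
  shows "d1 \<le> weight (x + y) \<or> d1 + d2 \<le> weight (x + y) + card J"
proof -
  define SA where "SA = {i \<in> A. x i \<noteq> 0}"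
  define SJ where "SJ = {i \<in> J. x i \<noteq> 0}"
  define SI where "SI = {i \<in> I. y i \<noteq> 0}"
  have fin: "finite SA" "finite SJ" "finite SI"
    using finite_parts by (auto simp: SA_def SJ_def SI_def)
  have disj: "SA \<inter> SJ = {}" "SA \<inter> SI = {}" using disjoint by (auto simp: SA_def SJ_def SI_def)
  have y_supp: "y \<in> supp_space (I \<union> J)" using y P_supp by auto
  have "{i. x i \<noteq> 0} = SA \<union> SJ" using x(1) by (auto simp: SA_def SJ_def supp_space_def)
  then have wx: "weight x = card SA + card SJ"
    using fin disj by (simp add: weight_def card_Un_disjoint)
  have "{i. (x + y) i \<noteq> 0} = SA \<union> SI"
  proof (intro equalityI subsetI)
    fix i assume i: "i \<in> {i. (x + y) i \<noteq> 0}"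
    then have "i \<in> A \<union> I" using xy unfolding supp_space_def by blast
    then show "i \<in> SA \<union> SI"
    proof
      assume "i \<in> A"
      then have "y i = 0" using disjoint y_supp by (auto simp: supp_space_def)
      then show ?thesis using i \<open>i \<in> A\<close> by (auto simp: SA_def)
    next
      assume "i \<in> I"
      then have "x i = 0" using disjoint x(1) by (auto simp: supp_space_def)
      then show ?thesis using i \<open>i \<in> I\<close> by (auto simp: SI_def)
    qed
  next
    fix i assume "i \<in> SA \<union> SI"
    moreover have "i \<in> SA \<Longrightarrow> y i = 0" "i \<in> SI \<Longrightarrow> x i = 0"
      using disjoint x(1) y_supp by (auto simp: supp_space_def SA_def SI_def)
    ultimately show "i \<in> {i. (x + y) i \<noteq> 0}" by (auto simp: SA_def SI_def)
  qed
  then have wxy: "weight (x + y) = card SA + card SI"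
    using fin disj by (simp add: weight_def card_Un_disjoint)
  show ?thesis
  proof (cases "SJ = {}")
    case True
    then show ?thesis using wx wxy x(2) by simp
  next
    case False
    then obtain j where j: "j \<in> J" "x j \<noteq> 0" by (auto simp: SJ_def)
    then have "j \<notin> A \<union> I" using disjoint by auto
    then have "x j + y j = 0" using xy by (auto simp: supp_space_def)
    then have "y j = x j" by (simp add: bit_pair_add_eq_0_iff)
    then have "y \<noteq> 0" using j by auto
    \<comment> \<open>The part \<open>v\<close> of \<open>y\<close> on \<open>I\<close> is
      orthogonal to \<open>P \<inter> supp_space I\<close>, because \<open>y\<close> is and the rest
      of \<open>y\<close> has disjoint support. If \<open>v\<close> were 0, then \<open>y\<close>
      would be supported on \<open>J\<close>, hence 0 by \<open>P_Int_supp_space\<close>.\<close>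
    define v where "v = (\<lambda>i. if i \<in> I then y i else 0)"
    define u where "u = (\<lambda>i. if i \<in> J then y i else 0)"
    have yvu: "y = v + u" and vu: "v \<in> supp_space I" "u \<in> supp_space J"
      using y_supp disjoint by (auto simp: v_def u_def supp_space_def fun_eq_iff)
    have "form v w = 0" if "w \<in> P \<inter> supp_space I" for w
    proof -
      have "form y w = 0" using y that isotropic_P by (auto simp: dual_def)
      moreover have "form u w = 0" using form_disjoint[OF vu(2), of w I] that disjoint by auto
      ultimately show ?thesis by (simp add: yvu form_add_left)
    qed
    then have "v \<in> dual I (P \<inter> supp_space I)" using vu by (simp add: dual_def)
    moreover have "v \<noteq> 0"
      using yvu vu(2) y \<open>y \<noteq> 0\<close> P_Int_supp_space by auto
    ultimately have "d2 \<le> weight v" by (rule d2)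
    moreover have "{i. v i \<noteq> 0} = SI" by (auto simp: v_def SI_def)
    moreover have "card SJ \<le> card J" by (auto simp: SJ_def intro: card_mono finite_parts)
    ultimately show ?thesis using wx wxy x(2) by (simp add: weight_def)
  qed
qed

end

section \<open>Relabelling the coordinates of pair vectors\<close>

lemma half_index:
  assumes "v \<in> carrier_vec (2 * n)" "i < n"
  shows "vec_first v n $ i = v $ i" "vec_last v n $ i = v $ (n + i)"
  using assms by (auto simp: vec_first_def vec_last_def)

text \<open>Coordinate \<open>j\<close> carries both the x-entry and the y-entry at position
  \<open>\<tau> j\<close>. The freedom in \<open>\<tau>\<close> lets a code of length
  \<open>n\<close> be placed on any coordinate set of that size.\<close>

definition relabel :: "nat \<Rightarrow> 'i set \<Rightarrow> ('i \<Rightarrow> nat) \<Rightarrow> bit vec \<Rightarrow> 'i \<Rightarrow> bit \<times> bit" where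
  "relabel n I \<tau> v = (\<lambda>j. if j \<in> I then (v $ \<tau> j, v $ (n + \<tau> j)) else 0)"

locale relabelling = symplectic_space \<Omega> for \<Omega> :: "'i set" +
  fixes n :: nat and I :: "'i set" and \<tau> :: "'i \<Rightarrow> nat"
  assumes I_subset: "I \<subseteq> \<Omega>" and bij_\<tau>: "bij_betw \<tau> I {..<n}"
begin

abbreviation enc :: "bit vec \<Rightarrow> 'i \<Rightarrow> bit \<times> bit" where
  "enc \<equiv> relabel n I \<tau>"

lemma \<tau>_less: "j \<in> I \<Longrightarrow> \<tau> j < n"
  using bij_\<tau> by (auto simp: bij_betw_def)

lemma bij_enc: "bij_betw enc (carrier_vec (2 * n)) (supp_space I)"
proof (rule bij_betwI[where g = "\<lambda>w. vec (2 * n) (\<lambda>i. if i < n then fst (w (inv_into I \<tau> i))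
    else snd (w (inv_into I \<tau> (i - n))))"])
  have inv: "inv_into I \<tau> i \<in> I" "\<tau> (inv_into I \<tau> i) = i" if "i < n" for i
    using bij_\<tau> that by (auto simp: bij_betw_def inv_into_into f_inv_into_f)
  have inv2: "inv_into I \<tau> (\<tau> j) = j" if "j \<in> I" for j
    using bij_\<tau> that by (auto simp: bij_betw_def)
  show "enc \<in> carrier_vec (2 * n) \<rightarrow> supp_space I"
    by (auto simp: relabel_def supp_space_def)
  show "vec (2 * n) (\<lambda>i. if i < n then fst (enc v (inv_into I \<tau> i))
    else snd (enc v (inv_into I \<tau> (i - n)))) = v" if "v \<in> carrier_vec (2 * n)" for v
    using that inv by (intro eq_vecI) (auto simp: relabel_def)
  show "enc (vec (2 * n) (\<lambda>i. if i < n then fst (w (inv_into I \<tau> i))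
    else snd (w (inv_into I \<tau> (i - n))))) = w" if "w \<in> supp_space I" for w
    using that inv2 \<tau>_less by (fastforce simp: relabel_def supp_space_def fun_eq_iff)
qed auto

lemma enc_add:
  "v \<in> carrier_vec (2 * n) \<Longrightarrow> w \<in> carrier_vec (2 * n) \<Longrightarrow> enc (v + w) = enc v + enc w"
  using \<tau>_less by (fastforce simp: relabel_def fun_eq_iff)

lemma enc_0: "enc (0\<^sub>v (2 * n)) = 0"
  using \<tau>_less by (fastforce simp: relabel_def fun_eq_iff zero_prod_def)

lemma weight_enc:
  assumes "v \<in> carrier_vec (2 * n)"
  shows "weight (enc v) = swt n v"
proof -
  have "bij_betw \<tau> {j \<in> I. (v $ \<tau> j, v $ (n + \<tau> j)) \<noteq> 0} {i \<in> {..<n}. (v $ i, v $ (n + i)) \<noteq> 0}"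
    using bij_\<tau> unfolding bij_betw_def by (auto intro: inj_on_subset)
  moreover have "{j. enc v j \<noteq> 0} = {j \<in> I. (v $ \<tau> j, v $ (n + \<tau> j)) \<noteq> 0}"
    by (auto simp: relabel_def)
  moreover have "{i. i < n \<and> (vec_first v n $ i, vec_last v n $ i) \<noteq> (0, 0)} =
      {i \<in> {..<n}. (v $ i, v $ (n + i)) \<noteq> 0}"
    using half_index[OF assms] by (auto simp: zero_prod_def)
  ultimately show ?thesis unfolding weight_def swt_def by (simp only: bij_betw_same_card)
qed

lemma form_enc:
  assumes "v \<in> carrier_vec (2 * n)" "w \<in> carrier_vec (2 * n)"
  shows "form (enc v) (enc w) = symp_prod n v w"
proof -
  have "form (enc v) (enc w) = (\<Sum>i\<in>I. v $ \<tau> i * w $ (n + \<tau> i) + v $ (n + \<tau> i) * w $ \<tau> i)"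
    unfolding form_def using I_subset finite_\<Omega>
    by (intro sum.mono_neutral_cong_right) (auto simp: relabel_def)
  also have "\<dots> = (\<Sum>i<n. v $ i * w $ (n + i) + v $ (n + i) * w $ i)"
    using sum.reindex_bij_betw[OF bij_\<tau>, of "\<lambda>i. v $ i * w $ (n + i) + v $ (n + i) * w $ i"] .
  also have "\<dots> = symp_prod n v w"
    using half_index[OF assms(1)] half_index[OF assms(2)]
    by (simp add: symp_prod_def scalar_prod_def sum.distrib atLeast0LessThan algebra_simps)
  finally show ?thesis .
qed

lemma enc_symp_dual:
  assumes "C \<subseteq> carrier_vec (2 * n)"
  shows "enc ` symp_dual n C = dual I (enc ` C)"
proof -
  have "enc v \<in> dual I (enc ` C) \<longleftrightarrow> v \<in> symp_dual n C" if "v \<in> carrier_vec (2 * n)" for v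
    using that assms form_enc[OF that] bij_betw_apply[OF bij_enc that]
    by (auto simp: dual_def symp_dual_def subset_iff)
  then show ?thesis
    using bij_betw_imp_surj_on[OF bij_enc] dual_subset[of I "enc ` C"]
    by (force simp: symp_dual_def)
qed

lemma enc_Int:
  assumes "S \<subseteq> carrier_vec (2 * n)" "T \<subseteq> carrier_vec (2 * n)"
  shows "enc ` (S \<inter> T) = enc ` S \<inter> enc ` T"
  using inj_on_image_Int[OF bij_betw_imp_inj_on[OF bij_enc] assms] .

lemma card_enc: "S \<subseteq> carrier_vec (2 * n) \<Longrightarrow> card (enc ` S) = card S"
  by (meson bij_betw_imp_inj_on bij_enc card_image inj_on_subset)

lemma subgroup_iff_additive_code:
  assumes C: "C \<subseteq> carrier_vec (2 * n)"
  shows "subgroup C (monoid_vec TYPE(bit) (2 * n)) \<longleftrightarrow> additive_code (enc ` C)"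
proof
  assume sub: "subgroup C (monoid_vec TYPE(bit) (2 * n))"
  have "0 \<in> enc ` C"
    using subgroup.one_closed[OF sub] enc_0 by (force simp: monoid_vec_simps)
  moreover have "enc v + enc w \<in> enc ` C" if "v \<in> C" "w \<in> C" for v w
    using subgroup.m_closed[OF sub that] enc_add[of v w] that C
    by (force simp: monoid_vec_simps)
  ultimately show "additive_code (enc ` C)" by (auto simp: additive_code_def)
next
  assume code: "additive_code (enc ` C)"
  interpret G: comm_group "monoid_vec TYPE(bit) (2 * n)" by (rule comm_group_vec)
  have inj: "v \<in> C" if "enc v \<in> enc ` C" "v \<in> carrier_vec (2 * n)" for v
    using that C bij_betw_imp_inj_on[OF bij_enc] by (auto dest!: inj_onD)
  have zero: "0\<^sub>v (2 * n) \<in> C"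
    using additive_codeD(1)[OF code] enc_0 by (intro inj) auto
  show "subgroup C (monoid_vec TYPE(bit) (2 * n))"
  proof (rule G.subgroupI)
    show "C \<subseteq> carrier (monoid_vec TYPE(bit) (2 * n))" using C by (simp add: monoid_vec_simps)
    show "C \<noteq> {}" using zero by auto
    show "v \<otimes>\<^bsub>monoid_vec TYPE(bit) (2 * n)\<^esub> w \<in> C" if "v \<in> C" "w \<in> C" for v w
    proof -
      have carrier: "v \<in> carrier_vec (2 * n)" "w \<in> carrier_vec (2 * n)" using that C by auto
      then have "enc (v + w) \<in> enc ` C"
        using that additive_codeD(2)[OF code] by (simp add: enc_add)
      then show ?thesis using carrier by (auto simp: monoid_vec_simps intro: inj)
    qed
    show "inv\<^bsub>monoid_vec TYPE(bit) (2 * n)\<^esub> v \<in> C" if "v \<in> C" for v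
    proof -
      have "v + v = 0\<^sub>v (2 * n)" using that C by (intro eq_vecI) auto
      then have "inv\<^bsub>monoid_vec TYPE(bit) (2 * n)\<^esub> v = v"
        using that C by (intro G.inv_equality) (auto simp: monoid_vec_simps)
      then show ?thesis using that by simp
    qed
  qed
qed

section \<open>From subsystem codes to stabilizers and back\<close>

lemma stabilizer_of_pure_subsystem_code:
  assumes "ex_pure_subsystem_code n (2 ^ k) (2 ^ r) d"
  obtains D where "additive_code D" "D \<subseteq> dual I D" "card D * 2 ^ (k + r) = 2 ^ n"
    "\<And>v. v \<in> dual I D \<Longrightarrow> v \<noteq> 0 \<Longrightarrow> d \<le> weight v"
proof -
  obtain C where C: "gives_subsystem_code n C (2 ^ k) (2 ^ r) d" and pure: "pure_to n C d"
    using assms by (auto simp: ex_pure_subsystem_code_def)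
  define D where "D = C \<inter> symp_dual n C"
  have sub: "subgroup C (monoid_vec TYPE(bit) (2 * n))"
    and card_D: "real (card D) = 2 ^ n / (2 ^ k * 2 ^ r)"
    and d: "d = (if symp_dual n D \<noteq> C then min_swt n (symp_dual n D - C)
             else min_swt n (symp_dual n D))"
    using C by (auto simp: gives_subsystem_code_def D_def Let_def)
  have C_sub: "C \<subseteq> carrier_vec (2 * n)"
    using subgroup.subset[OF sub] by (simp add: monoid_vec_simps)
  have dual_sub: "symp_dual n S \<subseteq> carrier_vec (2 * n)" for S by (auto simp: symp_dual_def)
  have D_sub: "D \<subseteq> carrier_vec (2 * n)" using C_sub by (auto simp: D_def)
  have enc_D: "enc ` D = enc ` C \<inter> dual I (enc ` C)"
    unfolding D_def enc_Int[OF C_sub dual_sub] enc_symp_dual[OF C_sub] ..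
  have "additive_code (enc ` D)"
    unfolding enc_D using sub subgroup_iff_additive_code[OF C_sub]
    by (intro additive_code_Int additive_code_dual) auto
  moreover have "enc ` D \<subseteq> dual I (enc ` D)"
    unfolding enc_D by (auto simp: dual_def)
  moreover have "card (enc ` D) * 2 ^ (k + r) = 2 ^ n"
  proof -
    have "real (card D * 2 ^ (k + r)) = real (2 ^ n)" using card_D by (simp add: power_add)
    then show ?thesis unfolding card_enc[OF D_sub] by (simp only: of_nat_eq_iff)
  qed
  moreover have "d \<le> weight v" if v: "v \<in> dual I (enc ` D)" "v \<noteq> 0" for v
  proof -
    obtain u where u: "u \<in> symp_dual n D" "v = enc u"
      using v(1) enc_symp_dual[OF D_sub] by auto
    then have u_carrier: "u \<in> carrier_vec (2 * n)" using dual_sub by auto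
    have u0: "u \<noteq> 0\<^sub>v (2 * n)" using v(2) u(2) enc_0 by auto
    have "d \<le> swt n u"
    proof (cases "u \<in> C")
      case True
      then show ?thesis using pure u0 by (force simp: pure_to_def)
    next
      case False
      \<comment> \<open>As \<open>u\<close> lies in the dual of \<open>D\<close> but not in
        \<open>C\<close>, the two sets differ and the first case of the definition of
        \<open>d\<close> applies.\<close>
      then have "d = Inf (swt n ` (symp_dual n D - C - {0\<^sub>v (2 * n)}))"
        using d u(1) by (auto simp: min_swt_def)
      also have "\<dots> \<le> swt n u" using False u(1) u0 by (intro cInf_lower) auto
      finally show ?thesis .
    qed
    then show ?thesis using weight_enc[OF u_carrier] u(2) by simp
  qed
  ultimately show ?thesis by (rule that)
qed

text \<open>The strict bound \<open>r < m\<close> makes \<open>C\<close> a proper subset of the dual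
  of \<open>D\<close>, so the distance is a minimum over vectors outside \<open>C\<close>; these are
  also outside \<open>D\<close>, where \<open>b\<close> applies. The bound is an integer because it
  may be negative in the application.\<close>

lemma subsystem_code_of_stabilizer:
  assumes D: "additive_code D" "D \<subseteq> dual I D" "card D * 2 ^ m = 2 ^ n" and r: "r < m"
    and b: "\<And>v. v \<in> dual I D \<Longrightarrow> v \<notin> D \<Longrightarrow> b \<le> int (weight v)"
  shows "\<exists>d. ex_subsystem_code n (2 ^ (m - r)) (2 ^ r) d \<and> b \<le> int d"
proof -
  have card_I: "card I = n" using bij_betw_same_card[OF bij_\<tau>] by simp
  obtain C where C: "additive_code C" "C \<subseteq> supp_space I" "C \<inter> dual I C = D" "card C = card D * 4 ^ r"
    using extend_by_hyperbolic_pairs[OF I_subset D(1,2), of m r] D(3) r card_I by auto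
  define C' where "C' = {v \<in> carrier_vec (2 * n). enc v \<in> C}"
  define D' where "D' = C' \<inter> symp_dual n C'"
  have C'_sub: "C' \<subseteq> carrier_vec (2 * n)" by (auto simp: C'_def)
  have dual_sub: "symp_dual n S \<subseteq> carrier_vec (2 * n)" for S by (auto simp: symp_dual_def)
  have D'_sub: "D' \<subseteq> carrier_vec (2 * n)" using C'_sub by (auto simp: D'_def)
  have enc_C': "enc ` C' = C"
    using bij_betw_imp_surj_on[OF bij_enc] C(2) by (auto simp: C'_def)
  have enc_D': "enc ` D' = D"
    unfolding D'_def enc_Int[OF C'_sub dual_sub] enc_symp_dual[OF C'_sub] enc_C' C(3) ..
  have sub: "subgroup C' (monoid_vec TYPE(bit) (2 * n))"
    using subgroup_iff_additive_code[OF C'_sub] enc_C' C(1) by simp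
  have card': "card C' = card C" "card D' = card D"
    using card_enc[OF C'_sub] card_enc[OF D'_sub] enc_C' enc_D' by auto
  have cD: "real (card D) * 2 ^ m = 2 ^ n"
    using arg_cong[OF D(3), of real] by simp
  have m: "(2::real) ^ m = 2 ^ (m - r) * 2 ^ r" using r by (simp flip: power_add)
  have "real (card D') = 2 ^ n / (real (2 ^ (m - r)) * real (2 ^ r))"
    unfolding card' cD[symmetric] m by simp
  moreover have "real (card C') = 2 ^ n * real (2 ^ r) / real (2 ^ (m - r))"
    unfolding card' cD[symmetric] C(4) m by (simp flip: power_mult_distrib)
  moreover define d where "d = (if symp_dual n D' \<noteq> C' then min_swt n (symp_dual n D' - C')
             else min_swt n (symp_dual n D'))"
  ultimately have "gives_subsystem_code n C' (2 ^ (m - r)) (2 ^ r) d"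
    using sub by (simp add: gives_subsystem_code_def Let_def D'_def)
  moreover have "b \<le> int d"
  proof -
    have D_supp: "D \<subseteq> supp_space I" using D(2) dual_subset by blast
    \<comment> \<open>The dual of \<open>D\<close> has \<open>card D * 4 ^ m\<close> elements and
      \<open>C\<close> has only \<open>card D * 4 ^ r\<close>.\<close>
    have "card D * card (dual I D) = 4 ^ n"
      using card_dual[OF I_subset D_supp D(1)] card_I by simp
    also have "\<dots> = (card D * 2 ^ m) * (card D * 2 ^ m)"
      unfolding D(3) by (simp flip: power_mult_distrib)
    finally have "card D * card (dual I D) = card D * (card D * 4 ^ m)"
      by (simp add: algebra_simps flip: power_mult_distrib)
    moreover have D0: "card D > 0" using D(3) by (metis gr0I mult_0 power_not_zero zero_neq_numeral)
    ultimately have "card C < card (dual I D)" using C(4) r by simp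
    then have "card C' < card (symp_dual n D')"
      using card' card_enc[OF dual_sub, of D'] enc_symp_dual[OF D'_sub] enc_D' by simp
    moreover have "finite C'"
      using card' C(4) D0 by (intro card_ge_0_finite) simp
    ultimately have "\<not> symp_dual n D' \<subseteq> C'" by (meson card_mono not_le)
    then have ne: "symp_dual n D' - C' \<noteq> {}" by auto
    define W where "W = swt n ` (symp_dual n D' - C' - {0\<^sub>v (2 * n)})"
    have "0\<^sub>v (2 * n) \<in> C'"
      using subgroup.one_closed[OF sub] by (simp add: monoid_vec_simps)
    \<comment> \<open>Removing the zero vector takes nothing away outside \<open>C'\<close>, so
      \<open>Inf\<close> is an attained minimum and not the default 0.\<close>
    then have "W \<noteq> {}" using ne by (auto simp: W_def)
    then have "Inf W \<in> W" by (rule Inf_nat_def1)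
    moreover have "d = Inf W" using ne by (auto simp: d_def min_swt_def W_def)
    ultimately obtain v where v: "v \<in> symp_dual n D'" "v \<notin> C'" "d = swt n v"
      by (auto simp: W_def)
    then have vc: "v \<in> carrier_vec (2 * n)" using dual_sub by auto
    have "enc v \<in> dual I D" using v(1) enc_symp_dual[OF D'_sub] enc_D' by auto
    moreover have "enc v \<notin> D" using v(2) vc C(3) by (auto simp: C'_def)
    ultimately show ?thesis using b weight_enc[OF vc] v(3) by metis
  qed
  ultimately show ?thesis by (auto simp: ex_subsystem_code_def)
qed

end

section \<open>Assembly of the glued code on a common coordinate line\<close>

theorem theorem27:
  fixes n1 k1 r1 d1 n2 k2 r2 d2 :: nat
  assumes "ex_pure_subsystem_code n1 (2 ^ k1) (2 ^ r1) d1"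
    and "ex_pure_subsystem_code n2 (2 ^ k2) (2 ^ r2) d2"
    and "k2 + r2 \<le> n1"
  shows "\<forall>r. 0 \<le> r \<and> r < k1 + r1 \<longrightarrow>
    (\<exists>d. ex_subsystem_code (n1 + n2 - k2 - r2) (2 ^ (k1 + r1 - r)) (2 ^ r) d \<and>
         int d \<ge> min (int d1) (int d1 + int d2 - int k2 - int r2))"
proof (intro allI impI)
  fix r assume r: "0 \<le> r \<and> r < k1 + r1"
  define k where "k = k2 + r2"
  define a where "a = n1 - k"
  define n where "n = a + n2"
  have k: "k \<le> n1" and n1: "n1 = a + k" using assms(3) by (auto simp: k_def a_def)
  \<comment> \<open>The \<open>n + k\<close> coordinates are arranged with the shared block
    \<open>J\<close> last, so that the new code occupies exactly the initial segment of length
    \<open>n\<close>.\<close>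
  define A I J :: "nat set" where "A = {..<a}" and "I = {a..<n}" and "J = {n..<n + k}"
  have AI: "A \<union> I = {..<n}" by (auto simp: A_def I_def n_def)
  interpret symplectic_space "{..<n + k}" by unfold_locales simp
  interpret R1: relabelling "{..<n + k}" n1 "A \<union> J" "\<lambda>i. if i < a then i else i - n2"
  proof
    show "bij_betw (\<lambda>i. if i < a then i else i - n2) (A \<union> J) {..<n1}"
      by (rule bij_betwI[where g = "\<lambda>i. if i < a then i else i + n2"])
        (auto simp: A_def J_def n_def n1)
  qed (auto simp: A_def J_def n_def)
  interpret R2: relabelling "{..<n + k}" n2 I "\<lambda>i. i - a"
  proof
    show "bij_betw (\<lambda>i. i - a) I {..<n2}"
      by (rule bij_betwI[where g = "\<lambda>i. i + a"]) (auto simp: I_def n_def)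
  qed (auto simp: I_def)
  interpret R: relabelling "{..<n + k}" n "{..<n}" "\<lambda>i. i"
    by unfold_locales (auto simp: bij_betw_def)
  obtain D1 where D1: "additive_code D1" "D1 \<subseteq> dual (A \<union> J) D1" "card D1 * 2 ^ (k1 + r1) = 2 ^ n1"
    "\<And>v. v \<in> dual (A \<union> J) D1 \<Longrightarrow> v \<noteq> 0 \<Longrightarrow> d1 \<le> weight v"
    using R1.stabilizer_of_pure_subsystem_code[OF assms(1)] by metis
  obtain D2 where D2: "additive_code D2" "D2 \<subseteq> dual I D2" "card D2 * 2 ^ k = 2 ^ n2"
    "\<And>v. v \<in> dual I D2 \<Longrightarrow> v \<noteq> 0 \<Longrightarrow> d2 \<le> weight v"
    using R2.stabilizer_of_pure_subsystem_code[OF assms(2)] unfolding k_def by metis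
  have card_IJ: "card I = n2" "card J = k" by (auto simp: I_def J_def n_def)
  have "I \<union> J \<subseteq> {..<n + k}" "I \<inter> J = {}" by (auto simp: I_def J_def)
  then obtain P where P: "additive_code P" "P \<subseteq> dual (I \<union> J) P" "P \<inter> supp_space I = D2"
    "card P = card D2 * 4 ^ k"
    using isotropic_extension[of I J D2 k] D2 card_IJ by auto
  have size_P: "card P = 2 ^ (n2 + k)"
  proof -
    have "card P = card D2 * 2 ^ k * 2 ^ k" unfolding P(4) by (simp flip: power_mult_distrib)
    also have "\<dots> = 2 ^ (n2 + k)" unfolding D2(3) by (simp add: power_add)
    finally show ?thesis .
  qed
  interpret contraction "{..<n + k}" A I J P
  proof
    show "card P * card P = 4 ^ (card I + card J)"
      unfolding size_P card_IJ by (simp flip: power_mult_distrib)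
    show "card (P \<inter> supp_space I) * 4 ^ card J = card P" using P(3,4) card_IJ by simp
  qed (use P in \<open>auto simp: A_def I_def J_def n_def\<close>)
  have D1_supp: "D1 \<subseteq> supp_space (A \<union> J)" using D1(2) dual_subset by blast
  have dual_D: "dual {..<n} (contract D1) = contract (dual (A \<union> J) D1)"
    using dual_contract[OF D1_supp D1(1)] by (simp add: AI)
  define b where "b = min (int d1) (int d1 + int d2 - int k2 - int r2)"
  have "\<exists>d. ex_subsystem_code n (2 ^ (k1 + r1 - r)) (2 ^ r) d \<and> b \<le> int d"
  proof (rule R.subsystem_code_of_stabilizer)
    show "additive_code (contract D1)" by (rule additive_code_contract[OF D1(1)])
    show "contract D1 \<subseteq> dual {..<n} (contract D1)"
      unfolding dual_D by (rule contract_mono[OF D1(2)])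
    \<comment> \<open>In exponents of 2 the count is \<open>n1 + n2 + k = n + 2 * k\<close>, and the
      factor \<open>4 ^ k\<close> cancels.\<close>
    have "card (contract D1) * 4 ^ k * 2 ^ (k1 + r1) = (card D1 * 2 ^ (k1 + r1)) * card P"
      using card_contract[OF D1_supp D1(1)] card_IJ by simp
    also have "\<dots> = 2 ^ n * 2 ^ k * 2 ^ k"
      unfolding D1(3) size_P by (simp add: n1 n_def power_add)
    also have "\<dots> = 2 ^ n * 4 ^ k"
      by (simp flip: power_mult_distrib)
    finally show "card (contract D1) * 2 ^ (k1 + r1) = 2 ^ n" by simp
    show "r < k1 + r1" using r by simp
  next
    fix v assume v: "v \<in> dual {..<n} (contract D1)" "v \<notin> contract D1"
    then obtain x y where xy: "v = x + y" "x \<in> dual (A \<union> J) D1" "y \<in> P" "x + y \<in> supp_space (A \<union> I)"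
      unfolding dual_D by (auto elim: contractE)
    \<comment> \<open>If \<open>x\<close> were 0, then \<open>v\<close> would be an element of
      \<open>P\<close> vanishing on \<open>J\<close>, hence in the contracted stabilizer. Such
      vectors can have small weight, which is why only vectors outside the stabilizer are
      bounded.\<close>
    have "x \<noteq> 0"
    proof
      assume "x = 0"
      then have "v \<in> D1 + P"
        using xy set_plus_intro[OF additive_codeD(1)[OF D1(1)] xy(3)] by simp
      then show False using v(2) xy by (simp add: contract_def)
    qed
    then have "d1 \<le> weight x" using D1(4) xy(2) by blast
    then have "d1 \<le> weight v \<or> d1 + d2 \<le> weight v + k"
      using weight_contract[OF _ _ xy(3,4), of d1 d2] xy(1,2) dual_subset D2(4) P(3) card_IJ by auto
    then show "b \<le> int (weight v)" by (auto simp: b_def k_def)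
  qed
  moreover have "n1 + n2 - k2 - r2 = n" using n1 by (simp add: n_def k_def)
  ultimately show "\<exists>d. ex_subsystem_code (n1 + n2 - k2 - r2) (2 ^ (k1 + r1 - r)) (2 ^ r) d \<and>
      int d \<ge> min (int d1) (int d1 + int d2 - int k2 - int r2)"
    by (simp add: b_def)
qed

end
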